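(* If $X$ is a finite metric space with $n$ points then $|tX|\to n$ as $t\to\infty$.
   Context: A weighting on a finite metric space $(X,d)$ is a choice of real number $w_x$ for each $x\in X$ such that $\sum_{x'\in X} e^{-d(x,x')}w_{x'}=1$ for every $x\in X$. If a weighting exists, the magnitude of $X$ is defined to be $|X| := \sum_{x\in X} w_x$; this is independent of the choice of weighting. If no weighting exists the magnitude is undefined. For $t>0$, $tX$ denotes the metric space with the same points as $X$ and metric $d_{tX}(x,x') := t\,d_X(x,x')$. The magnitude $|tX|$ is defined for all sufficiently large $t$ (this depends on $X$), so the limit as $t\to\infty$ makes sense. *)

theory Defs
  imports "HOL-Analysis.Abstract_Metric_Spaces"
begin

definition is_weighting :: "'a set \<Rightarrow> ('a \<Rightarrow> 'a \<Rightarrow> real) \<Rightarrow> ('a \<Rightarrow> real) \<Rightarrow> bool" where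
  "is_weighting X d w \<longleftrightarrow> (\<forall>x\<in>X. (\<Sum>x'\<in>X. exp (- d x x') * w x') = 1)"

definition has_weighting :: "'a set \<Rightarrow> ('a \<Rightarrow> 'a \<Rightarrow> real) \<Rightarrow> bool" where
  "has_weighting X d \<longleftrightarrow> (\<exists>w. is_weighting X d w)"

(* Meaningful only if has_weighting X d; otherwise the value is unspecified. *)
definition magnitude :: "'a set \<Rightarrow> ('a \<Rightarrow> 'a \<Rightarrow> real) \<Rightarrow> real" where
  "magnitude X d = (THE m. \<exists>w. is_weighting X d w \<and> m = (\<Sum>x\<in>X. w x))"

definition scale_metric :: "real \<Rightarrow> ('a \<Rightarrow> 'a \<Rightarrow> real) \<Rightarrow> 'a \<Rightarrow> 'a \<Rightarrow> real" where
  "scale_metric t d = (\<lambda>x x'. t * d x x')"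

lemma Metric_space_scale_metric:
  assumes "Metric_space X d" and "t > 0"
  shows "Metric_space X (scale_metric t d)"
proof -
  interpret Metric_space X d by fact
  show ?thesis
  proof
    show "scale_metric t d x z \<le> scale_metric t d x y + scale_metric t d y z"
      if "x \<in> X" "y \<in> X" "z \<in> X" for x y z
      using mult_left_mono[OF triangle[OF that], of t] assms(2)
      by (simp add: scale_metric_def distrib_left)
  qed (use assms(2) in \<open>auto simp: scale_metric_def commute\<close>)
qed

lemma sum_weighting_unique:
  assumes "Metric_space X d" and "is_weighting X d v" and "is_weighting X d w"
  shows "(\<Sum>x\<in>X. v x) = (\<Sum>x\<in>X. w x)"
proof -
  interpret Metric_space X d by fact
  have "(\<Sum>x\<in>X. v x) = (\<Sum>x\<in>X. \<Sum>y\<in>X. v x * (exp (- d x y) * w y))"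
    using assms(3) by (simp add: is_weighting_def flip: sum_distrib_left)
  also have "\<dots> = (\<Sum>y\<in>X. \<Sum>x\<in>X. v x * (exp (- d x y) * w y))"
    by (rule sum.swap)
  also have "\<dots> = (\<Sum>y\<in>X. \<Sum>x\<in>X. w y * (exp (- d y x) * v x))"
    by (simp add: commute mult_ac)
  also have "\<dots> = (\<Sum>y\<in>X. w y)"
    using assms(2) by (simp add: is_weighting_def flip: sum_distrib_left)
  finally show ?thesis .
qed

lemma magnitude_eq:
  assumes "Metric_space X d" and "is_weighting X d w"
  shows "magnitude X d = (\<Sum>x\<in>X. w x)"
  unfolding magnitude_def
  by (rule the_equality) (use assms sum_weighting_unique in blast)+

end

theory Submission
  imports Defs
begin

text \<open>
  As \<open>t\<close> grows, the matrix with entries \<open>exp (- t * d x y)\<close> tends to the identity, so the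
  Neumann series gives, for large \<open>t\<close>, a weighting all of whose entries are close to \<open>1\<close>.
\<close>

text \<open>The solution is the sum over \<open>k\<close> of the \<open>k\<close>-th power of the
  matrix \<open>a\<close> applied to the constant vector 1. Each application shrinks the sup norm by
  a factor \<open>q\<close>, so the series converges geometrically.\<close>

lemma neumann_series_solution:
  fixes a :: "'a \<Rightarrow> 'a \<Rightarrow> real"
  assumes "0 \<le> q" "q < 1" and row: "\<And>x. x \<in> X \<Longrightarrow> (\<Sum>y\<in>X. \<bar>a x y\<bar>) \<le> q"
  obtains w where "\<And>x. x \<in> X \<Longrightarrow> w x = 1 + (\<Sum>y\<in>X. a x y * w y)"
    and "\<And>x. x \<in> X \<Longrightarrow> \<bar>w x - 1\<bar> \<le> q / (1 - q)"
proof -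
  \<comment> \<open>\<open>u k\<close> is the \<open>k\<close>-th power of \<open>a\<close> applied
    to the constant vector 1.\<close>
  define u :: "nat \<Rightarrow> 'a \<Rightarrow> real"
    where "u = rec_nat (\<lambda>x. 1) (\<lambda>k v x. \<Sum>y\<in>X. a x y * v y)"
  have u_0: "u 0 x = 1" and u_Suc: "u (Suc k) x = (\<Sum>y\<in>X. a x y * u k y)" for k x
    by (simp_all add: u_def)
  define w where "w = (\<lambda>x. \<Sum>k. u k x)"
  have u_bound: "\<bar>u k x\<bar> \<le> q ^ k" if "x \<in> X" for k x
    using that
  proof (induction k arbitrary: x)
    case 0
    then show ?case by (simp add: u_0)
  next
    case (Suc k)
    have "\<bar>u (Suc k) x\<bar> \<le> (\<Sum>y\<in>X. \<bar>a x y * u k y\<bar>)"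
      unfolding u_Suc by (rule sum_abs)
    also have "\<dots> \<le> (\<Sum>y\<in>X. \<bar>a x y\<bar> * q ^ k)"
      by (rule sum_mono) (simp add: abs_mult mult_left_mono Suc.IH)
    also have "\<dots> \<le> q * q ^ k"
      unfolding sum_distrib_right[symmetric]
      using row[OF Suc.prems] \<open>0 \<le> q\<close> by (intro mult_right_mono) auto
    finally show ?case by simp
  qed
  have geom: "summable (\<lambda>k. q ^ k)"
    using assms(1,2) by (simp add: summable_geometric)
  have summable_u: "summable (\<lambda>k. u k x)" if "x \<in> X" for x
    using u_bound[OF that] by (intro summable_comparison_test'[OF geom]) auto
  \<comment> \<open>The term for \<open>k = 0\<close> is exactly 1, so the error is a tail whose
    geometric majorant starts at exponent 1; hence \<open>q / (1 - q)\<close>.\<close>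
  have w_split: "w x - 1 = (\<Sum>k. u (Suc k) x)" if "x \<in> X" for x
    using suminf_split_head[OF summable_u[OF that]] by (simp add: w_def u_0)
  show thesis
  proof
    fix x assume "x \<in> X"
    \<comment> \<open>Applying \<open>a\<close> termwise shifts the series by one index, which gives
      the fixed-point equation.\<close>
    have "(\<Sum>k. u (Suc k) x) = (\<Sum>y\<in>X. \<Sum>k. a x y * u k y)"
      unfolding u_Suc by (rule suminf_sum) (simp add: summable_mult summable_u)
    also have "\<dots> = (\<Sum>y\<in>X. a x y * w y)"
      by (intro sum.cong refl) (simp add: w_def suminf_mult summable_u)
    finally show "w x = 1 + (\<Sum>y\<in>X. a x y * w y)"
      using w_split[OF \<open>x \<in> X\<close>] by simp
    have "\<bar>w x - 1\<bar> \<le> (\<Sum>k. q ^ Suc k)"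
      unfolding w_split[OF \<open>x \<in> X\<close>] real_norm_def[symmetric]
      using u_bound[OF \<open>x \<in> X\<close>, of "Suc _"] geom
      by (intro norm_suminf_le summable_Suc_iff[THEN iffD2]) (simp_all del: power_Suc)
    also have "\<dots> = q / (1 - q)"
      using assms(1,2) geom by (simp add: suminf_mult suminf_geometric)
    finally show "\<bar>w x - 1\<bar> \<le> q / (1 - q)" .
  qed
qed

text \<open>Summing over all rows gives a single number that dominates every row sum and whose limit
  can be taken term by term, with no maximum over rows.\<close>

definition offdiag_sum :: "'a set \<Rightarrow> ('a \<Rightarrow> 'a \<Rightarrow> real) \<Rightarrow> real" where
  "offdiag_sum X d = (\<Sum>x\<in>X. \<Sum>y\<in>X - {x}. exp (- d x y))"

lemma offdiag_sum_nonneg: "0 \<le> offdiag_sum X d"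
  by (simp add: offdiag_sum_def sum_nonneg)

text \<open>With \<open>a\<close> the identity minus the matrix of entries
  \<open>exp (- d x y)\<close>, the weighting equation becomes the fixed-point equation
  \<open>w = 1 + a w\<close>, whose row sums are at most \<open>offdiag_sum X d\<close>.\<close>

lemma weighting_near_one:
  assumes "Metric_space X d" "finite X" and less: "offdiag_sum X d < 1"
  obtains w where "is_weighting X d w"
    and "\<And>x. x \<in> X \<Longrightarrow> \<bar>w x - 1\<bar> \<le> offdiag_sum X d / (1 - offdiag_sum X d)"
proof -
  interpret Metric_space X d by fact
  \<comment> \<open>The diagonal vanishes because \<open>exp (- d x x) = 1\<close>.\<close>
  define a where "a x y = (if x = y then 0 else - exp (- d x y))" for x y
  have row: "(\<Sum>y\<in>X. \<bar>a x y\<bar>) \<le> offdiag_sum X d" if "x \<in> X" for x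
  proof -
    have "(\<Sum>y\<in>X. \<bar>a x y\<bar>) = (\<Sum>y\<in>X - {x}. exp (- d x y))"
      using that \<open>finite X\<close> by (auto simp: sum.remove[of X x] a_def intro!: sum.cong split: if_splits)
    \<comment> \<open>The row of \<open>x\<close> is one of the nonnegative summands.\<close>
    also have "\<dots> \<le> offdiag_sum X d"
      unfolding offdiag_sum_def
      using that \<open>finite X\<close>
      by (intro member_le_sum[where f = "\<lambda>x. \<Sum>y\<in>X - {x}. exp (- d x y)"])
        (auto intro: sum_nonneg)
    finally show ?thesis .
  qed
  obtain w where w: "\<And>x. x \<in> X \<Longrightarrow> w x = 1 + (\<Sum>y\<in>X. a x y * w y)"
    and near: "\<And>x. x \<in> X \<Longrightarrow> \<bar>w x - 1\<bar> \<le> offdiag_sum X d / (1 - offdiag_sum X d)"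
    by (rule neumann_series_solution[OF offdiag_sum_nonneg less row]) blast+
  have "is_weighting X d w"
    unfolding is_weighting_def
  proof
    fix x assume "x \<in> X"
    have "(\<Sum>y\<in>X. a x y * w y) = (\<Sum>y\<in>X - {x}. a x y * w y)"
      using \<open>x \<in> X\<close> \<open>finite X\<close> by (simp add: sum.remove[of X x] a_def)
    also have "\<dots> = (\<Sum>y\<in>X - {x}. - (exp (- d x y) * w y))"
      by (intro sum.cong refl) (auto simp: a_def)
    also have "\<dots> = - (\<Sum>y\<in>X - {x}. exp (- d x y) * w y)"
      by (rule sum_negf)
    finally have "w x = 1 - (\<Sum>y\<in>X - {x}. exp (- d x y) * w y)"
      using w[OF \<open>x \<in> X\<close>] by linarith
    then show "(\<Sum>y\<in>X. exp (- d x y) * w y) = 1"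
      using \<open>x \<in> X\<close> \<open>finite X\<close> by (simp add: sum.remove[of X x])
  qed
  then show thesis using near that by blast
qed

text \<open>Distinct points lie at positive distance, so each off-diagonal term decays exponentially
  in \<open>t\<close>.\<close>

lemma offdiag_sum_scale_tendsto_0:
  assumes "Metric_space X d"
  shows "((\<lambda>t. offdiag_sum X (scale_metric t d)) \<longlongrightarrow> 0) at_top"
  unfolding offdiag_sum_def scale_metric_def
proof (intro tendsto_null_sum)
  interpret Metric_space X d by fact
  fix x y assume "x \<in> X" "y \<in> X - {x}"
  then have "0 < d x y" by (auto intro: mdist_pos_less)
  then have "filterlim (\<lambda>t. t * d x y) at_top at_top"
    by (intro filterlim_at_top_mult_tendsto_pos[OF tendsto_const] filterlim_ident)
  then show "((\<lambda>t. exp (- (t * d x y))) \<longlongrightarrow> 0) at_top"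
    by (intro filterlim_compose[OF exp_at_bot] filterlim_compose[OF filterlim_uminus_at_bot_at_top])
qed

theorem theorem3:
  fixes X :: "'a set" and d :: "'a \<Rightarrow> 'a \<Rightarrow> real" and n :: nat
  assumes "Metric_space X d" and "finite X" and "card X = n"
  shows "(\<forall>\<^sub>F t in at_top. has_weighting X (scale_metric t d)) \<and>
         ((\<lambda>t. magnitude X (scale_metric t d)) \<longlongrightarrow> real n) at_top"
proof -
  define q where "q t = offdiag_sum X (scale_metric t d)" for t
  have q_lim: "(q \<longlongrightarrow> 0) at_top"
    using offdiag_sum_scale_tendsto_0[OF assms(1)] by (simp add: q_def[abs_def])
  have "\<forall>\<^sub>F t in at_top. q t < 1"
    using q_lim by (rule order_tendstoD) simp
  then have "\<forall>\<^sub>F t in at_top. has_weighting X (scale_metric t d) \<and>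
      norm (magnitude X (scale_metric t d) - real n) \<le> real n * (q t / (1 - q t))"
    \<comment> \<open>Positivity of \<open>t\<close> makes the scaled distance a metric.\<close>
    using eventually_gt_at_top[of 0]
  proof eventually_elim
    case (elim t)
    have M: "Metric_space X (scale_metric t d)"
      by (rule Metric_space_scale_metric) fact+
    obtain w where w: "is_weighting X (scale_metric t d) w"
      and near: "\<And>x. x \<in> X \<Longrightarrow> \<bar>w x - 1\<bar> \<le> q t / (1 - q t)"
      using weighting_near_one[OF M \<open>finite X\<close>] elim(1) unfolding q_def by blast
    \<comment> \<open>Any weighting computes the magnitude, and \<open>n\<close> is the sum of 1
      over \<open>X\<close>, so the error splits into pointwise errors.\<close>
    have "\<bar>magnitude X (scale_metric t d) - real n\<bar> = \<bar>\<Sum>x\<in>X. w x - 1\<bar>"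
      using assms(3) by (simp add: magnitude_eq[OF M w] sum_subtractf)
    also have "\<dots> \<le> (\<Sum>x\<in>X. \<bar>w x - 1\<bar>)"
      by (rule sum_abs)
    also have "\<dots> \<le> real n * (q t / (1 - q t))"
      using sum_bounded_above[of X, OF near] assms(3) by simp
    finally show ?case
      using w by (auto simp: has_weighting_def)
  qed
  moreover have "((\<lambda>t. real n * (q t / (1 - q t))) \<longlongrightarrow> 0) at_top"
    by (rule tendsto_eq_intros q_lim refl | simp)+
  ultimately show ?thesis
    unfolding eventually_conj_iff using LIM_zero_cancel Lim_null_comparison by metis
qed

end
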